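(* Let $A\in\mathbb{R}^{m\times m}$ and $W\in\mathbb{R}^{m\times m}$ be symmetric positive definite, let $b\in\mathbb{R}^m$, and let $w^*$ be a solution of $Aw=b$. Let $\mathcal{D}$ be a distribution over matrices in $\mathbb{R}^{m\times\tau}$ and let $S_0,S_1,\ldots$ be sampled i.i.d. from $\mathcal{D}$. Let $0<\eta<1$ and, for all $k\ge 0$, let $\eta_k=\eta$ and $$\zeta_0=0,\qquad \zeta_k=k(1-\eta)\ \text{ for }k\ge 1.$$ Let $w^0\in\mathbb{R}^m$, $w^{-1}=w^0$, $z^{-1}=w^0$, and for $k\ge 0$ let $$z^k=z^{k-1}-\eta\,\nabla_W f_{S_k}(w^k),\qquad w^{k+1}=\left(1-\frac{1}{\zeta_{k+1}+1}\right)w^k+\frac{1}{\zeta_{k+1}+1}z^k;$$ equivalently, $w^{k+1}=w^k-\gamma_k\nabla_W f_{S_k}(w^k)+\beta_k(w^k-w^{k-1})$ with $$\gamma_k=\frac{\eta}{(k+1)(1-\eta)+1}\quad\text{and}\quad\beta_k=1-\frac{2-\eta}{(k+1)(1-\eta)+1}.$$ Then for every $k\ge 1$, $$\mathbb{E}\left[\|Aw^k-b\|^2\right]\le\frac{1}{\lambda_{\min}(\mathbb{E}[H_S])}\,\frac1k\,\frac{\|w^0-w^*\|_W^2}{\eta(1-\eta)}.$$ Consequently, for $\eta=\frac12$ and any $\epsilon>0$, if $$t\ge\frac{4\|w^0-w^*\|_W^2}{\lambda_{\min}(\mathbb{E}[H_S])}\,\frac1\epsilon,$$ then $\mathbb{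E}\left[\|Aw^t-b\|^2\right]<\epsilon$.
   Context: Norms: $\|\cdot\|$ is the Euclidean norm and $\|x\|_W=\sqrt{\langle x,Wx\rangle}$. For $S\in\mathbb{R}^{m\times\tau}$ define $$H_S := S\,(S^\top A W^{-1} A S)^{\dagger}S^\top,\qquad f_S(w):=\tfrac12 (Aw-b)^\top H_S(Aw-b),\qquad \nabla_W f_S(w):=W^{-1}AH_S(Aw-b),$$ where $\dagger$ is the Moore–Penrose pseudoinverse ($\nabla_W f_S$ is the gradient of $f_S$ relative to the inner product $\langle x,y\rangle_W=\langle Wx,y\rangle$). $\mathbb{E}[H_S]$ is the expectation over $S\sim\mathcal{D}$, and $\lambda_{\min}$ denotes the smallest eigenvalue. Quotients with denominator $\lambda_{\min}(\mathbb{E}[H_S])$ are read as $+\infty$ if $\lambda_{\min}(\mathbb{E}[H_S])=0$. Iteration counts $k,t$ are integers. *)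

theory Defs
  imports "HOL-Probability.Probability"
begin

text \<open>Real \<open>p \<times> q\<close> matrices have type \<^typ>\<open>real^'q^'p\<close>: the outer index is the row.\<close>

definition sym_pos_def :: "real^'n^'n \<Rightarrow> bool" where
  "sym_pos_def B \<longleftrightarrow> transpose B = B \<and> (\<forall>x. x \<noteq> 0 \<longrightarrow> 0 < x \<bullet> (B *v x))"

text \<open>The four Penrose equations determine the Moore--Penrose pseudoinverse uniquely.\<close>

definition is_pinv :: "real^'n^'m \<Rightarrow> real^'m^'n \<Rightarrow> bool" where
  "is_pinv M X \<longleftrightarrow>
     M ** X ** M = M \<and> X ** M ** X = X \<and>
     transpose (M ** X) = M ** X \<and> transpose (X ** M) = X ** M"

definition pinv :: "real^'n^'m \<Rightarrow> real^'m^'n" where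
  "pinv M = (THE X. is_pinv M X)"

definition is_eigenvalue :: "real^'n^'n \<Rightarrow> real \<Rightarrow> bool" where
  "is_eigenvalue B l \<longleftrightarrow> (\<exists>v. v \<noteq> 0 \<and> B *v v = l *\<^sub>R v)"

text \<open>Only meaningful when \<open>B\<close> has a real eigenvalue, e.g. when \<open>B\<close> is symmetric.\<close>

definition lambda_min :: "real^'n^'n \<Rightarrow> real" where
  "lambda_min B = (LEAST l. is_eigenvalue B l)"

definition wnorm :: "real^'n^'n \<Rightarrow> real^'n \<Rightarrow> real" where
  "wnorm W x = sqrt (x \<bullet> (W *v x))"

definition H_mat :: "real^'m^'m \<Rightarrow> real^'m^'m \<Rightarrow> real^'t^'m \<Rightarrow> real^'m^'m" where
  "H_mat A W S = S ** pinv (transpose S ** A ** matrix_inv W ** A ** S) ** transpose S"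

text \<open>For symmetric \<open>A\<close> and \<open>W\<close> this is the gradient of
  \<open>w \<mapsto> 1/2 (A w - b)\<^sup>T H\<^sub>S (A w - b)\<close> for the inner product \<open>\<langle>x, y\<rangle>\<^sub>W = \<langle>W x, y\<rangle>\<close>.\<close>

definition grad_W ::
  "real^'m^'m \<Rightarrow> real^'m^'m \<Rightarrow> real^'m \<Rightarrow> real^'t^'m \<Rightarrow> real^'m \<Rightarrow> real^'m" where
  "grad_W A W b S w = (matrix_inv W ** A ** H_mat A W S) *v (A *v w - b)"

text \<open>Bochner integral; \<open>H_mat A W\<close> is bounded when \<open>A\<close> and \<open>W\<close> are symmetric positive definite.\<close>

definition expected_H :: "real^'m^'m \<Rightarrow> real^'m^'m \<Rightarrow> (real^'t^'m) measure \<Rightarrow> real^'m^'m" where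
  "expected_H A W D = (\<integral>S. H_mat A W S \<partial>D)"

definition zeta :: "real \<Rightarrow> nat \<Rightarrow> real" where
  "zeta \<eta> k = (if k = 0 then 0 else real k * (1 - \<eta>))"

definition gamma_coeff :: "real \<Rightarrow> nat \<Rightarrow> real" where
  "gamma_coeff \<eta> k = \<eta> / ((real k + 1) * (1 - \<eta>) + 1)"

definition beta_coeff :: "real \<Rightarrow> nat \<Rightarrow> real" where
  "beta_coeff \<eta> k = 1 - (2 - \<eta>) / ((real k + 1) * (1 - \<eta>) + 1)"

text \<open>Both forms of the iteration, along one sample path \<open>s\<close>. Sequences of iterates are
  indexed by \<^typ>\<open>int\<close> because they start at index \<open>-1\<close>; values below that are unconstrained.\<close>

definition averaging_iterates ::
  "real^'m^'m \<Rightarrow> real^'m^'m \<Rightarrow> real^'m \<Rightarrow> real \<Rightarrow> (nat \<Rightarrow> real^'t^'m) \<Rightarrow> real^'m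
    \<Rightarrow> (int \<Rightarrow> real^'m) \<Rightarrow> (int \<Rightarrow> real^'m) \<Rightarrow> bool" where
  "averaging_iterates A W b \<eta> s w0 w z \<longleftrightarrow>
     w 0 = w0 \<and> w (-1) = w0 \<and> z (-1) = w0 \<and>
     (\<forall>k::nat.
        z (int k) = z (int k - 1) - \<eta> *\<^sub>R grad_W A W b (s k) (w (int k)) \<and>
        w (int k + 1) = (1 - 1 / (zeta \<eta> (k + 1) + 1)) *\<^sub>R w (int k)
                          + (1 / (zeta \<eta> (k + 1) + 1)) *\<^sub>R z (int k))"

definition momentum_iterates ::
  "real^'m^'m \<Rightarrow> real^'m^'m \<Rightarrow> real^'m \<Rightarrow> real \<Rightarrow> (nat \<Rightarrow> real^'t^'m) \<Rightarrow> real^'m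
    \<Rightarrow> (int \<Rightarrow> real^'m) \<Rightarrow> bool" where
  "momentum_iterates A W b \<eta> s w0 w \<longleftrightarrow>
     w 0 = w0 \<and> w (-1) = w0 \<and>
     (\<forall>k::nat.
        w (int k + 1) = w (int k) - gamma_coeff \<eta> k *\<^sub>R grad_W A W b (s k) (w (int k))
                          + beta_coeff \<eta> k *\<^sub>R (w (int k) - w (int k - 1)))"

text \<open>The quotient \<open>a / l\<close> of nonnegative reals, read as \<open>\<infinity>\<close> whenever \<open>l = 0\<close>.
  Division on \<^typ>\<open>ennreal\<close> differs in that \<open>0 / 0 = 0\<close> there.\<close>

definition quot_inf :: "real \<Rightarrow> real \<Rightarrow> ennreal" where
  "quot_inf a l = (if l = 0 then \<infinity> else ennreal (a / l))"

end

theory Submission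
  imports Defs
begin

text \<open>
  Put \<open>Q\<^sub>S(e) = 2 f\<^sub>S(w)\<close> for \<open>e = w - w\<^sup>*\<close>. The Penrose equations give
  \<open>H\<^sub>S A W\<^sup>-\<^sup>1 A H\<^sub>S = H\<^sub>S\<close>, hence the squared \<open>W\<close>-norm of the gradient of \<open>f\<^sub>S\<close> at \<open>w\<close> and its
  \<open>W\<close>-inner product with \<open>e\<close> both equal \<open>Q\<^sub>S(e)\<close>. Writing
  \<open>z\<^sup>k\<^sup>-\<^sup>1 = w\<^sup>k + \<zeta>\<^sub>k (w\<^sup>k - w\<^sup>k\<^sup>-\<^sup>1)\<close> and using convexity of \<open>f\<^sub>S\<close>, one step decreases the squared
  \<open>W\<close>-distance of \<open>z\<close> to \<open>w\<^sup>*\<close> by at least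
  \<open>\<eta> (\<zeta>\<^sub>k + 2 - \<eta>) Q\<^sub>S(e\<^sup>k) - \<eta> \<zeta>\<^sub>k Q\<^sub>S(e\<^sup>k\<^sup>-\<^sup>1)\<close>. The sample \<open>S\<^sub>k\<close> is independent of \<open>w\<^sup>k\<close> and
  \<open>w\<^sup>k\<^sup>-\<^sup>1\<close>, so in expectation \<open>Q\<^sub>S\<close> may be replaced by the quadratic form of the mean of \<open>H\<^sub>S\<close>.
  The resulting inequalities telescope because \<open>\<zeta>\<^sub>k\<^sub>+\<^sub>1 = \<zeta>\<^sub>k + 1 - \<eta> \<le> \<zeta>\<^sub>k + 2 - \<eta>\<close>. What remains is a bound with
  denominator \<open>k (1 - \<eta>) + 2 - \<eta>\<close>, whose excess over \<open>k (1 - \<eta>)\<close> gives the strict inequality of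
  the complexity statement.
\<close>

section \<open>Pseudoinverses of symmetric matrices\<close>

lemma inner_matrix_vector_transpose:
  fixes C :: "real^'n^'m"
  shows "x \<bullet> (C *v y) = (transpose C *v x) \<bullet> y"
  by (metis dot_lmul_matrix transpose_matrix_vector)

text \<open>\<open>M ** X\<close> and \<open>M ** Z\<close> are orthogonal projections onto the same
  range, hence equal, and likewise \<open>X ** M\<close> and \<open>Z ** M\<close>. So
  \<open>X = X ** M ** X = X ** M ** Z = Z ** M ** Z = Z\<close>.\<close>

lemma is_pinv_unique:
  fixes M :: "real^'n^'m"
  assumes X: "is_pinv M X" and Z: "is_pinv M Z"
  shows "X = Z"
proof -
  have x: "M ** X ** M = M" "X ** M ** X = X" "transpose (M ** X) = M ** X" "transpose (X ** M) = X ** M"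
    and z: "M ** Z ** M = M" "Z ** M ** Z = Z" "transpose (M ** Z) = M ** Z" "transpose (Z ** M) = Z ** M"
    using X Z by (auto simp: is_pinv_def)
  have "M ** X = transpose ((M ** Z) ** (M ** X))"
    by (simp add: matrix_mul_assoc x z)
  also have "\<dots> = (M ** X) ** (M ** Z)"
    by (simp only: matrix_transpose_mul[of "M ** Z"] x z)
  also have "\<dots> = M ** Z"
    by (simp add: matrix_mul_assoc x)
  finally have l: "M ** X = M ** Z" .
  have "X ** M = transpose ((X ** M) ** (Z ** M))"
    by (simp add: x z flip: matrix_mul_assoc) (simp add: matrix_mul_assoc x z)
  also have "\<dots> = (Z ** M) ** (X ** M)"
    by (simp only: matrix_transpose_mul[of "X ** M"] x z)
  also have "\<dots> = Z ** M"
    by (simp add: x flip: matrix_mul_assoc) (simp add: matrix_mul_assoc x)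
  finally have r: "X ** M = Z ** M" .
  show ?thesis
    by (metis l r x(2) z(2) matrix_mul_assoc)
qed

text \<open>The component of \<open>P *v x\<close> orthogonal to the range of \<open>P ** P\<close>
  is killed by \<open>P\<close>, hence orthogonal to the range of \<open>P\<close>, and therefore
  zero.\<close>

lemma symmetric_matrix_range_square:
  fixes P :: "real^'n^'n"
  assumes sym: "transpose P = P"
  shows "\<exists>y. P *v x = (P ** P) *v y"
proof -
  have sub: "subspace (range ((*v) (P ** P)))"
    using linear_subspace_image[OF matrix_vector_mul_linear subspace_UNIV] .
  obtain u v where u: "u \<in> span (range ((*v) (P ** P)))"
    and v: "\<And>w. w \<in> span (range ((*v) (P ** P))) \<Longrightarrow> orthogonal v w" and uv: "P *v x = u + v"
    using orthogonal_subspace_decomp_exists by blast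
  have "(P *v v) \<bullet> (P *v v) = v \<bullet> ((P ** P) *v v)"
    by (simp add: inner_matrix_vector_transpose sym flip: matrix_vector_mul_assoc)
  also have "\<dots> = 0"
    using v[of "(P ** P) *v v"] by (auto simp: orthogonal_def intro: span_base)
  finally have "P *v v = 0"
    by simp
  moreover have "v \<bullet> v = (P *v v) \<bullet> x - v \<bullet> u"
    using uv by (metis add_diff_cancel_left' inner_diff_right inner_matrix_vector_transpose sym)
  ultimately have "v = 0"
    using v[OF u] by (simp add: orthogonal_def)
  then show ?thesis
    using u uv sub by (auto simp: span_eq_iff[THEN iffD2])
qed

text \<open>Preimages of the columns of \<open>P\<close> under \<open>P ** P\<close> become the
  columns of \<open>Y\<close>. The pseudoinverse is then built from \<open>Y\<close> without
  diagonalising \<open>P\<close>.\<close>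

lemma symmetric_matrix_factor_square:
  fixes P :: "real^'n^'n"
  assumes "transpose P = P"
  obtains Y where "P = P ** P ** Y"
proof -
  obtain f where f: "P *v x = (P ** P) *v f x" for x
    using symmetric_matrix_range_square[OF assms] by metis
  define Y :: "real^'n^'n" where "Y = (\<chi> i j. f (axis j 1) $ i)"
  have Y: "Y *v axis j 1 = f (axis j 1)" for j
    by (simp add: Y_def matrix_vector_mult_basis column_def)
  have "column j P = column j (P ** P ** Y)" for j
    using f[of "axis j 1"] Y[of j]
    by (metis matrix_vector_mult_basis matrix_vector_mul_assoc)
  then have "P = P ** P ** Y"
    by (simp add: vec_eq_iff column_def)
  then show ?thesis by (rule that)
qed

text \<open>\<open>pinv\<close> is a definite description, so existence is needed besides
  uniqueness. The symmetric case suffices because the matrix inverted in \<open>H_mat\<close> is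
  symmetric.\<close>

lemma is_pinv_pinv_symmetric:
  fixes P :: "real^'n^'n"
  assumes sym: "transpose P = P"
  shows "is_pinv P (pinv P)" and "transpose (pinv P) = pinv P"
proof -
  obtain Y where Y: "P = P ** P ** Y"
    using symmetric_matrix_factor_square[OF sym] .
  define Q where "Q = P ** Y"
  have PQ: "P ** Q = P"
    using Y by (simp add: Q_def matrix_mul_assoc)
  have "transpose Q = transpose Y ** P"
    by (simp add: Q_def matrix_transpose_mul sym)
  moreover have "transpose Y ** P ** P = P"
    using arg_cong[OF Y, of transpose] by (simp add: matrix_transpose_mul sym matrix_mul_assoc)
  \<comment> \<open>A product of this form is symmetric, so one identity makes \<open>Q\<close> both
    symmetric and idempotent.\<close>
  ultimately have tQQ: "transpose Q ** Q = Q"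
    by (simp add: Q_def matrix_mul_assoc)
  then have tQ: "transpose Q = Q"
    by (metis matrix_transpose_mul transpose_transpose)
  have QP: "Q ** P = P"
    by (metis PQ tQ sym matrix_transpose_mul)
  \<comment> \<open>\<open>Q\<close> is the orthogonal projection onto the range of \<open>P\<close>, and \<open>X\<close> inverts \<open>P\<close> on that range.\<close>
  define X where "X = transpose Y ** P ** Y"
  have XQ: "X = Q ** Y"
    using \<open>transpose Q = transpose Y ** P\<close> tQ by (simp add: X_def)
  have tX: "transpose X = X"
    by (simp add: X_def matrix_transpose_mul sym matrix_mul_assoc)
  have PX: "P ** X = Q"
    by (simp add: XQ matrix_mul_assoc PQ) (simp add: Q_def)
  have XP: "X ** P = Q"
    by (metis PX tX tQ sym matrix_transpose_mul)
  have "X ** P ** X = X"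
    by (metis XP XQ tQ tQQ matrix_mul_assoc)
  then have X: "is_pinv P X"
    by (simp add: is_pinv_def PX XP QP tQ)
  then have "pinv P = X"
    unfolding pinv_def by (blast intro: is_pinv_unique)
  then show "is_pinv P (pinv P)" "transpose (pinv P) = pinv P"
    using X tX by auto
qed

section \<open>Positive definite matrices and the sketched matrix H_S\<close>

lemma sym_pos_defD:
  assumes "sym_pos_def B"
  shows "transpose B = B" and "0 \<le> x \<bullet> (B *v x)" and "x \<bullet> (B *v x) = 0 \<longleftrightarrow> x = 0"
proof -
  show "transpose B = B" and "0 \<le> x \<bullet> (B *v x)"
    using assms by (cases "x = 0"; force simp: sym_pos_def_def)+
  show "x \<bullet> (B *v x) = 0 \<longleftrightarrow> x = 0"
    using assms by (cases "x = 0") (force simp: sym_pos_def_def)+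
qed

lemma wnorm_square:
  assumes "sym_pos_def W"
  shows "(wnorm W x)\<^sup>2 = x \<bullet> (W *v x)"
  by (simp add: wnorm_def sym_pos_defD(2)[OF assms])

lemma sym_pos_def_inverse:
  assumes "sym_pos_def W"
  shows "W ** matrix_inv W = mat 1" and "transpose (matrix_inv W) = matrix_inv W"
    and "0 \<le> x \<bullet> (matrix_inv W *v x)"
proof -
  note W = sym_pos_defD[OF assms]
  have "\<forall>x. W *v x = 0 \<longrightarrow> x = 0"
    using W(3) by (metis inner_zero_right)
  then have "invertible W"
    by (metis invertible_left_inverse matrix_left_invertible_ker)
  then have i: "W ** matrix_inv W = mat 1 \<and> matrix_inv W ** W = mat 1"
    unfolding invertible_def matrix_inv_def by (rule someI_ex)
  then show 1: "W ** matrix_inv W = mat 1" by simp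
  have "transpose (matrix_inv W) ** W = mat 1"
    by (metis 1 W(1) matrix_transpose_mul transpose_mat)
  then show "transpose (matrix_inv W) = matrix_inv W"
    by (metis 1 matrix_mul_assoc matrix_mul_lid matrix_mul_rid)
  have "x = W *v (matrix_inv W *v x)"
    by (simp add: matrix_vector_mul_assoc 1)
  then show "0 \<le> x \<bullet> (matrix_inv W *v x)"
    using W(2)[of "matrix_inv W *v x"] by (simp add: inner_commute)
qed

context
  fixes A W :: "real^'m^'m"
  assumes A: "sym_pos_def A" and W: "sym_pos_def W"
begin

text \<open>The factors around the middle regroup to \<open>pinv ?P ** ?P ** pinv ?P\<close>, which
  the second Penrose equation collapses.\<close>

lemma H_mat_symmetric: "transpose (H_mat A W S) = H_mat A W S"
  and H_mat_idem: "H_mat A W S ** (A ** matrix_inv W ** A) ** H_mat A W S = H_mat A W S"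
proof -
  let ?P = "transpose S ** A ** matrix_inv W ** A ** S"
  have "transpose ?P = ?P"
    using sym_pos_defD(1)[OF A] sym_pos_def_inverse(2)[OF W]
    by (simp add: matrix_transpose_mul matrix_mul_assoc)
  note P = is_pinv_pinv_symmetric[OF this]
  show "transpose (H_mat A W S) = H_mat A W S"
    using P(2) by (simp add: H_mat_def matrix_transpose_mul matrix_mul_assoc)
  have "H_mat A W S ** (A ** matrix_inv W ** A) ** H_mat A W S
      = S ** (pinv ?P ** ?P ** pinv ?P) ** transpose S"
    by (simp add: H_mat_def matrix_mul_assoc)
  also have "\<dots> = H_mat A W S"
    using P(1) by (simp add: is_pinv_def H_mat_def)
  finally show "H_mat A W S ** (A ** matrix_inv W ** A) ** H_mat A W S = H_mat A W S" .
qed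

text \<open>Passing to the form of \<open>matrix_inv W\<close> gives positive semidefiniteness, and
  later equates the loss with the squared \<open>W\<close>-norm of the gradient.\<close>

lemma inner_H_mat: "x \<bullet> (H_mat A W S *v x)
    = (A *v (H_mat A W S *v x)) \<bullet> (matrix_inv W *v (A *v (H_mat A W S *v x)))"
proof -
  have "x \<bullet> (H_mat A W S *v x)
      = x \<bullet> (H_mat A W S *v (A *v (matrix_inv W *v (A *v (H_mat A W S *v x)))))"
    by (subst H_mat_idem[symmetric]) (simp add: matrix_vector_mul_assoc matrix_mul_assoc)
  then show ?thesis
    by (simp add: inner_matrix_vector_transpose H_mat_symmetric sym_pos_defD(1)[OF A])
qed

lemma inner_H_mat_nonneg: "0 \<le> x \<bullet> (H_mat A W S *v x)"
  by (simp add: inner_H_mat sym_pos_def_inverse(3)[OF W])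

end

section \<open>The smallest eigenvalue\<close>

text \<open>If \<open>C *v v\<close> were nonzero, a small move from \<open>v\<close> against it
  would make the form negative. In use, \<open>C\<close> is a symmetric matrix shifted by the
  minimum of its Rayleigh quotient.\<close>

lemma pos_semidef_quadratic_zero:
  fixes C :: "real^'n^'n"
  assumes sym: "transpose C = C" and psd: "\<And>x. 0 \<le> x \<bullet> (C *v x)" and zero: "v \<bullet> (C *v v) = 0"
  shows "C *v v = 0"
proof -
  define y where "y = C *v v"
  define q where "q = y \<bullet> (C *v y)"
  \<comment> \<open>The form at \<open>v - t y\<close> is \<open>t\<^sup>2 q - 2 t (y \<bullet> y)\<close>, which is negative for this \<open>t\<close> unless \<open>y = 0\<close>.\<close>
  define t where "t = (y \<bullet> y) / (q + 1)"
  have q: "0 \<le> q" unfolding q_def by (rule psd)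
  have "v \<bullet> (C *v y) = y \<bullet> y"
    by (simp add: inner_matrix_vector_transpose sym y_def)
  then have "(v - t *\<^sub>R y) \<bullet> (C *v (v - t *\<^sub>R y)) = t\<^sup>2 * q - 2 * t * (y \<bullet> y)"
    using zero by (simp add: matrix_vector_mult_diff_distrib matrix_vector_mult_scaleR
        inner_diff_left inner_diff_right q_def power2_eq_square algebra_simps flip: y_def)
  then have "2 * t * (y \<bullet> y) \<le> t\<^sup>2 * q"
    using psd[of "v - t *\<^sub>R y"] by simp
  \<comment> \<open>Multiplying by the square of \<open>q + 1\<close> clears the denominator of
    \<open>t\<close>; unlike \<open>q\<close>, it cannot vanish.\<close>
  then have "2 * (t * (q + 1)) * (y \<bullet> y) * (q + 1) \<le> (t * (q + 1))\<^sup>2 * q"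
    using q mult_right_mono[of _ _ "(q + 1)\<^sup>2"] by (fastforce simp: power2_eq_square algebra_simps)
  moreover have "t * (q + 1) = y \<bullet> y"
    using q by (simp add: t_def)
  ultimately have "2 * (y \<bullet> y) * (y \<bullet> y) * (q + 1) \<le> (y \<bullet> y)\<^sup>2 * q"
    by (simp only:)
  then have "(y \<bullet> y)\<^sup>2 * (q + 2) \<le> 0"
    by (simp add: power2_eq_square algebra_simps)
  with q have "(y \<bullet> y)\<^sup>2 \<le> 0"
    by (simp add: mult_le_0_iff)
  then show ?thesis
    by (simp add: y_def)
qed

text \<open>The form attains its minimum on the compact unit sphere. The minimiser is an eigenvector
  and the minimum bounds every eigenvalue from below, so the \<open>LEAST\<close> in
  \<open>lambda_min\<close> exists.\<close>

lemma lambda_min_symmetric: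
  fixes B :: "real^'n^'n"
  assumes sym: "transpose B = B"
  shows "is_eigenvalue B (lambda_min B)" and "lambda_min B * (x \<bullet> x) \<le> x \<bullet> (B *v x)"
proof -
  define q where "q x = x \<bullet> (B *v x)" for x
  have "continuous_on (sphere 0 1) q"
    unfolding q_def by (intro continuous_intros)
  moreover have "sphere (0 :: real^'n) 1 \<noteq> {}"
    by simp
  ultimately obtain v where v: "norm v = 1" and min: "\<And>x. norm x = 1 \<Longrightarrow> q v \<le> q x"
    using continuous_attains_inf[of "sphere 0 1" q] by auto
  have rayleigh: "q v * (x \<bullet> x) \<le> q x" for x
  proof (cases "x = 0")
    case False
    have "q v \<le> q (x /\<^sub>R norm x)"
      using False by (intro min) simp
    also have "\<dots> = q x / (x \<bullet> x)"
      using False by (simp add: q_def matrix_vector_mult_scaleR field_simps flip: dot_square_norm power2_eq_square)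
    finally show ?thesis
      using False by (simp add: field_simps)
  qed (simp add: q_def)
  have C: "(B - q v *\<^sub>R mat 1) *v x = B *v x - q v *\<^sub>R x" for x
    by (simp add: matrix_vector_mult_diff_rdistrib flip: scaleR_matrix_vector_assoc)
  have "(B - q v *\<^sub>R mat 1) *v v = 0"
  proof (rule pos_semidef_quadratic_zero)
    show "transpose (B - q v *\<^sub>R mat 1) = B - q v *\<^sub>R mat 1"
      using sym by (auto simp: vec_eq_iff transpose_def mat_def)
    show "0 \<le> x \<bullet> ((B - q v *\<^sub>R mat 1) *v x)" for x
      unfolding C using rayleigh[of x] by (simp add: inner_diff_right q_def)
    show "v \<bullet> ((B - q v *\<^sub>R mat 1) *v v) = 0"
      unfolding C using v by (simp add: inner_diff_right q_def dot_square_norm)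
  qed
  then have ev: "is_eigenvalue B (q v)"
    using v by (auto simp: is_eigenvalue_def C intro!: exI[of _ v])
  moreover have "q v \<le> l" if l: "is_eigenvalue B l" for l
  proof -
    obtain u where u: "u \<noteq> 0" "B *v u = l *\<^sub>R u"
      using l by (auto simp: is_eigenvalue_def)
    then show ?thesis
      using rayleigh[of u] by (simp add: q_def)
  qed
  ultimately have "lambda_min B = q v"
    unfolding lambda_min_def by (intro Least_equality)
  then show "is_eigenvalue B (lambda_min B)" "lambda_min B * (x \<bullet> x) \<le> x \<bullet> (B *v x)"
    using ev rayleigh[of x] by (auto simp: q_def)
qed

lemma lambda_min_zero: "lambda_min (0 :: real^'n^'n) = 0"
proof -
  have "transpose (0 :: real^'n^'n) = 0"
    by (simp add: transpose_def vec_eq_iff)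
  from lambda_min_symmetric(1)[OF this] show ?thesis
    by (auto simp: is_eigenvalue_def)
qed

section \<open>One step of the iteration\<close>

text \<open>Twice the objective \<open>f\<^sub>S\<close>, as a function of the error \<open>e = w - w\<^sup>*\<close>.\<close>

definition sketch_loss :: "real^'m^'m \<Rightarrow> real^'m^'m \<Rightarrow> real^'t^'m \<Rightarrow> real^'m \<Rightarrow> real" where
  "sketch_loss A W S e = (A *v e) \<bullet> (H_mat A W S *v (A *v e))"

lemma grad_W_solution:
  assumes "A *v wstar = b"
  shows "grad_W A W b S w = matrix_inv W *v (A *v (H_mat A W S *v (A *v (w - wstar))))"
  using assms by (simp add: grad_W_def matrix_vector_mul_assoc matrix_mul_assoc
      matrix_vector_mult_diff_distrib)

lemma sketch_loss_nonneg:
  assumes "sym_pos_def A" "sym_pos_def W"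
  shows "0 \<le> sketch_loss A W S e"
  unfolding sketch_loss_def by (rule inner_H_mat_nonneg[OF assms])

text \<open>Expand the nonnegative form of \<open>H_mat A W S\<close> at
  \<open>A *v (e - d)\<close>; the two cross terms agree by symmetry.\<close>

lemma sketch_loss_convex:
  assumes A: "sym_pos_def A" and W: "sym_pos_def W"
  shows "sketch_loss A W S e - sketch_loss A W S d
    \<le> 2 * ((A *v (e - d)) \<bullet> (H_mat A W S *v (A *v e)))"
proof -
  let ?H = "H_mat A W S"
  have "(A *v e) \<bullet> (?H *v (A *v d)) = (A *v d) \<bullet> (?H *v (A *v e))"
    using H_mat_symmetric[OF A W, of S] by (metis inner_commute inner_matrix_vector_transpose)
  then show ?thesis
    using inner_H_mat_nonneg[OF A W, of "A *v (e - d)" S]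
    by (simp add: sketch_loss_def matrix_vector_mult_diff_distrib inner_diff_left inner_diff_right)
qed

text \<open>Here \<open>u\<close>, \<open>w\<close>, \<open>y\<close> are the previous iterate, the
  current iterate and the previous auxiliary point. In the expanded square, convexity bounds the
  cross term, and the quadratic term is again a loss at \<open>w\<close>.\<close>

lemma averaging_step_descent:
  assumes A: "sym_pos_def A" and W: "sym_pos_def W" and b: "A *v wstar = b"
    and \<eta>: "0 < \<eta>" and \<zeta>: "0 \<le> \<zeta>" and w: "w = u + (1 / (\<zeta> + 1)) *\<^sub>R (y - u)"
  shows "(wnorm W (y - \<eta> *\<^sub>R grad_W A W b S w - wstar))\<^sup>2
      + \<eta> * (\<zeta> + 2 - \<eta>) * sketch_loss A W S (w - wstar)
    \<le> (wnorm W (y - wstar))\<^sup>2 + \<eta> * \<zeta> * sketch_loss A W S (u - wstar)"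
proof -
  define e where "e = w - wstar"
  define g where "g = grad_W A W b S w"
  define a where "a = y - wstar"
  define h where "h = H_mat A W S *v (A *v e)"
  have g: "g = matrix_inv W *v (A *v h)"
    unfolding g_def h_def e_def by (rule grad_W_solution[OF b])
  have Wg: "W *v g = A *v h"
    by (simp add: g matrix_vector_mul_assoc matrix_mul_assoc sym_pos_def_inverse(1)[OF W])
  have aWg: "a \<bullet> (W *v g) = (A *v a) \<bullet> h" for a
    by (simp add: Wg inner_matrix_vector_transpose sym_pos_defD(1)[OF A])
  have gWg: "g \<bullet> (W *v g) = sketch_loss A W S e"
    unfolding Wg by (simp add: sketch_loss_def inner_H_mat[OF A W, of "A *v e"] g h_def inner_commute)
  then have Agh: "(A *v g) \<bullet> h = sketch_loss A W S e"
    by (simp add: aWg)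
  \<comment> \<open>Solving the averaging step for \<open>y\<close> gives an extrapolation beyond
    \<open>w\<close> away from \<open>u\<close>. The first summand contributes the loss exactly, the
    second is treated by convexity.\<close>
  have a: "a = e + \<zeta> *\<^sub>R (e - (u - wstar))"
  proof -
    have "(\<zeta> + 1) *\<^sub>R (w - u) = y - u"
      using w \<zeta> by simp
    then have "y = w + \<zeta> *\<^sub>R (w - u)"
      by (simp add: algebra_simps)
    then show ?thesis
      by (simp add: a_def e_def)
  qed
  have "(A *v a) \<bullet> h = sketch_loss A W S e + \<zeta> * ((A *v (e - (u - wstar))) \<bullet> h)"
    by (simp add: a matrix_vector_right_distrib matrix_vector_mult_scaleR inner_add_left
        sketch_loss_def h_def)
  moreover have "\<zeta> * (sketch_loss A W S e - sketch_loss A W S (u - wstar))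
      \<le> \<zeta> * (2 * ((A *v (e - (u - wstar))) \<bullet> h))"
    unfolding h_def by (intro mult_left_mono sketch_loss_convex[OF A W] \<zeta>)
  ultimately have "2 * ((A *v a) \<bullet> h)
      \<ge> (2 + \<zeta>) * sketch_loss A W S e - \<zeta> * sketch_loss A W S (u - wstar)"
    by (simp add: algebra_simps)
  then have "\<eta> * (2 * ((A *v a) \<bullet> h))
      \<ge> \<eta> * ((2 + \<zeta>) * sketch_loss A W S e - \<zeta> * sketch_loss A W S (u - wstar))"
    using \<eta> by (intro mult_left_mono) auto
  moreover have "(wnorm W (a - \<eta> *\<^sub>R g))\<^sup>2
      = (wnorm W a)\<^sup>2 - \<eta> * (2 * ((A *v a) \<bullet> h)) + \<eta>\<^sup>2 * sketch_loss A W S e"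
  proof -
    have "g \<bullet> (W *v a) = a \<bullet> (W *v g)"
      using sym_pos_defD(1)[OF W] by (metis inner_commute inner_matrix_vector_transpose)
    then show ?thesis
      unfolding wnorm_square[OF W]
      by (simp add: matrix_vector_mult_diff_distrib
          matrix_vector_mult_scaleR inner_diff_left inner_diff_right aWg Agh algebra_simps power2_eq_square)
  qed
  ultimately show ?thesis
    by (simp add: a_def e_def g_def algebra_simps power2_eq_square)
qed

section \<open>Equivalence of the averaging and momentum forms\<close>

lemma zeta_eq: "zeta \<eta> k = real k * (1 - \<eta>)"
  by (simp add: zeta_def)

text \<open>For \<open>c\<close> and \<open>c'\<close> read \<open>zeta\<close> at \<open>k\<close>
  and \<open>k + 1\<close>, for \<open>y\<close> the auxiliary point at \<open>k - 1\<close>.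
  Eliminating \<open>y\<close> leaves the momentum coefficient \<open>c / (c' + 1)\<close>.\<close>

lemma averaging_step_iff_momentum_step:
  fixes u v w y g :: "real^'m"
  assumes "0 \<le> c" "\<eta> < 1" and y: "y = u + (c + 1) *\<^sub>R (w - u)"
  defines "c' \<equiv> c + (1 - \<eta>)"
  shows "v = (1 - 1 / (c' + 1)) *\<^sub>R w + (1 / (c' + 1)) *\<^sub>R (y - \<eta> *\<^sub>R g)
    \<longleftrightarrow> v = w - (\<eta> / (c' + 1)) *\<^sub>R g + (1 - (2 - \<eta>) / (c' + 1)) *\<^sub>R (w - u)"
proof -
  have nz: "c' + 1 \<noteq> 0"
    using assms by simp
  have "1 - (2 - \<eta>) / (c' + 1) = c / (c' + 1)"
    using nz by (simp add: field_simps) (simp add: c'_def)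
  then have "(1 - 1 / (c' + 1)) *\<^sub>R w + (1 / (c' + 1)) *\<^sub>R (y - \<eta> *\<^sub>R g)
    = w - (\<eta> / (c' + 1)) *\<^sub>R g + (1 - (2 - \<eta>) / (c' + 1)) *\<^sub>R (w - u)"
    by (simp add: y divide_inverse algebra_simps)
  then show ?thesis by simp
qed

lemma averaging_iff_momentum:
  fixes A W :: "real^'m^'m" and s :: "nat \<Rightarrow> real^'t^'m"
  assumes "\<eta> < 1"
  shows "(\<exists>v. averaging_iterates A W b \<eta> s w0 u v) \<longleftrightarrow> momentum_iterates A W b \<eta> s w0 u"
proof -
  define c where "c k = real k * (1 - \<eta>)" for k
  have c0: "0 \<le> c k" for k
    using assms by (simp add: c_def)
  have c: "c (Suc k) = c k + (1 - \<eta>)" "zeta \<eta> (Suc k) = c (Suc k)"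
    "(real k + 1) * (1 - \<eta>) = c (Suc k)" "c 0 = 0" for k
    using assms by (simp_all add: c_def zeta_eq algebra_simps)
  \<comment> \<open>The averaging form forces this value on the auxiliary point at index
    \<open>k - 1\<close>, so that sequence is recovered from the iterates alone.\<close>
  define y where "y k = u (int k - 1) + (c k + 1) *\<^sub>R (u (int k) - u (int k - 1))" for k
  have step: "u (int k + 1) = (1 - 1 / (zeta \<eta> (k + 1) + 1)) *\<^sub>R u (int k)
        + (1 / (zeta \<eta> (k + 1) + 1)) *\<^sub>R (y k - \<eta> *\<^sub>R grad_W A W b (s k) (u (int k)))
      \<longleftrightarrow> u (int k + 1) = u (int k) - gamma_coeff \<eta> k *\<^sub>R grad_W A W b (s k) (u (int k))
          + beta_coeff \<eta> k *\<^sub>R (u (int k) - u (int k - 1))" for k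
    unfolding gamma_coeff_def beta_coeff_def c(3)
    using averaging_step_iff_momentum_step[OF c0 assms y_def] by (simp add: c)
  have inv: "y (Suc k) = x" if "u (int k + 1) = (1 - 1 / (zeta \<eta> (k + 1) + 1)) *\<^sub>R u (int k)
        + (1 / (zeta \<eta> (k + 1) + 1)) *\<^sub>R x" for k x
  proof -
    have "c (Suc k) + 1 \<noteq> 0" using c0[of "Suc k"] by linarith
    moreover have "u (int k + 1) - u (int k) = (1 / (c (Suc k) + 1)) *\<^sub>R (x - u (int k))"
      using that by (simp add: c(2) algebra_simps)
    ultimately show ?thesis
      by (simp add: y_def add.commute)
  qed
  show ?thesis
  proof
    assume "\<exists>v. averaging_iterates A W b \<eta> s w0 u v"
    then obtain v where v: "averaging_iterates A W b \<eta> s w0 u v" ..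
    have y: "v (int k - 1) = y k" for k
    proof (cases k)
      case 0
      then show ?thesis using v by (simp add: averaging_iterates_def y_def)
    next
      case (Suc j)
      then show ?thesis using v inv[of j "v (int j)"] by (simp add: averaging_iterates_def)
    qed
    then show "momentum_iterates A W b \<eta> s w0 u"
      using v step by (simp add: averaging_iterates_def momentum_iterates_def)
  next
    assume u: "momentum_iterates A W b \<eta> s w0 u"
    \<comment> \<open>The shift by one matches \<open>y k\<close> with index \<open>k - 1\<close>;
      in particular \<open>v (-1) = y 0\<close>, which is \<open>w0\<close>.\<close>
    define v where "v i = y (nat (i + 1))" for i
    have "y (Suc k) = y k - \<eta> *\<^sub>R grad_W A W b (s k) (u (int k))" for k
      using u step[of k] by (intro inv) (simp add: momentum_iterates_def)
    then have "averaging_iterates A W b \<eta> s w0 u v"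
      using u step inv
      by (auto simp: averaging_iterates_def momentum_iterates_def v_def y_def[of 0] nat_add_distrib)
    then show "\<exists>v. averaging_iterates A W b \<eta> s w0 u v"
      by blast
  qed
qed

section \<open>Independence of the samples\<close>

text \<open>Independence makes the joint law a product, Tonelli splits it, and both marginal
  integrals are pulled back to \<open>M\<close>.\<close>

lemma (in prob_space) nn_integral_indep_var:
  assumes ind: "indep_var N X L Y" and h: "h \<in> borel_measurable (N \<Otimes>\<^sub>M L)"
  shows "(\<integral>\<^sup>+ \<omega>. h (X \<omega>, Y \<omega>) \<partial>M) = (\<integral>\<^sup>+ \<omega>. (\<integral>\<^sup>+ \<omega>'. h (X \<omega>, Y \<omega>') \<partial>M) \<partial>M)"
proof -
  have X: "X \<in> measurable M N" and Y: "Y \<in> measurable M L"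
    and eq: "distr M N X \<Otimes>\<^sub>M distr M L Y = distr M (N \<Otimes>\<^sub>M L) (\<lambda>x. (X x, Y x))"
    using ind by (auto simp: indep_var_distribution_eq)
  interpret Y: prob_space "distr M L Y"
    using Y by (rule prob_space_distr)
  have h': "h \<in> borel_measurable (distr M N X \<Otimes>\<^sub>M distr M L Y)"
    using h by (simp cong: measurable_cong_sets sets_pair_measure_cong)
  have "(\<integral>\<^sup>+ \<omega>. h (X \<omega>, Y \<omega>) \<partial>M) = (\<integral>\<^sup>+ p. h p \<partial>(distr M N X \<Otimes>\<^sub>M distr M L Y))"
    unfolding eq using X Y h by (subst nn_integral_distr) auto
  also have "\<dots> = (\<integral>\<^sup>+ x. \<integral>\<^sup>+ y. h (x, y) \<partial>distr M L Y \<partial>distr M N X)"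
    using h' by (rule Y.nn_integral_fst[symmetric])
  also have "\<dots> = (\<integral>\<^sup>+ \<omega>. (\<integral>\<^sup>+ y. h (X \<omega>, y) \<partial>distr M L Y) \<partial>M)"
    using Y.borel_measurable_nn_integral_fst[OF h'] by (intro nn_integral_distr[OF X]) simp
  also have "\<dots> = (\<integral>\<^sup>+ \<omega>. (\<integral>\<^sup>+ \<omega>'. h (X \<omega>, Y \<omega>') \<partial>M) \<partial>M)"
    using X Y h by (intro nn_integral_cong nn_integral_distr) (auto dest: measurable_space)
  finally show ?thesis .
qed

section \<open>Measurability of the iterates\<close>

lemma borel_measurable_matrix_vector_mult:
  fixes f :: "'a \<Rightarrow> real^'n^'m"
  assumes "f \<in> borel_measurable N" "g \<in> borel_measurable N"
  shows "(\<lambda>x. f x *v g x) \<in> borel_measurable N"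
proof (rule borel_measurable_continuous_Pair[OF assms])
  show "continuous_on UNIV (\<lambda>p. (fst p :: real^'n^'m) *v snd p)"
    unfolding matrix_vector_mult_def
    by (intro continuous_on_vec_lambda continuous_on_sum continuous_on_mult continuous_on_component
        continuous_on_fst continuous_on_snd continuous_on_id)
qed

text \<open>The triple \<open>(w\<^sup>k\<^sup>-\<^sup>1, w\<^sup>k, z\<^sup>k\<^sup>-\<^sup>1)\<close> as a function of the samples.\<close>

primrec iterate_state ::
  "real^'m^'m \<Rightarrow> real^'m^'m \<Rightarrow> real^'m \<Rightarrow> real \<Rightarrow> real^'m \<Rightarrow> (nat \<Rightarrow> real^'t^'m) \<Rightarrow> nat
    \<Rightarrow> (real^'m) \<times> (real^'m) \<times> (real^'m)" where
  "iterate_state A W b \<eta> w0 s 0 = (w0, w0, w0)"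
| "iterate_state A W b \<eta> w0 s (Suc k) =
    (let (u, w, y) = iterate_state A W b \<eta> w0 s k;
         z = y - \<eta> *\<^sub>R grad_W A W b (s k) w
     in (w, (1 - 1 / (zeta \<eta> (k + 1) + 1)) *\<^sub>R w + (1 / (zeta \<eta> (k + 1) + 1)) *\<^sub>R z, z))"

text \<open>\<open>averaging_iterates\<close> relates given sequences; the recursion makes them
  explicit functions of the samples, from which measurability follows.\<close>

lemma averaging_iterates_state:
  assumes "averaging_iterates A W b \<eta> s w0 w z"
  shows "iterate_state A W b \<eta> w0 s k = (w (int k - 1), w (int k), z (int k - 1))"
proof (induction k)
  case (Suc k)
  have "z (int k) = z (int k - 1) - \<eta> *\<^sub>R grad_W A W b (s k) (w (int k))"
    and "w (int k + 1) = (1 - 1 / (zeta \<eta> (k + 1) + 1)) *\<^sub>R w (int k)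
      + (1 / (zeta \<eta> (k + 1) + 1)) *\<^sub>R z (int k)"
    using assms unfolding averaging_iterates_def by blast+
  moreover have "int (Suc k) = int k + 1" "int (Suc k) - 1 = int k"
    by simp_all
  ultimately show ?case
    by (simp only: iterate_state.simps Suc.IH Let_def prod.case)
qed (use assms in \<open>simp add: averaging_iterates_def\<close>)

text \<open>Adaptedness: samples from index \<open>k\<close> on do not enter the state at
  \<open>k\<close>.\<close>

lemma iterate_state_cong:
  assumes "\<And>i. i < k \<Longrightarrow> s i = s' i"
  shows "iterate_state A W b \<eta> w0 s k = iterate_state A W b \<eta> w0 s' k"
  using assms by (induction k) simp_all

text \<open>The index set stays \<open>{..<k}\<close> while \<open>j\<close> varies, so the
  induction runs on one product space.\<close>

lemma measurable_iterate_state: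
  fixes A W :: "real^'m^'m" and b w0 :: "real^'m"
  assumes H: "(H_mat A W :: real^'t^'m \<Rightarrow> real^'m^'m) \<in> borel_measurable borel" and "j \<le> k"
  shows "(\<lambda>s :: nat \<Rightarrow> real^'t^'m. iterate_state A W b \<eta> w0 s j) \<in> borel_measurable (PiM {..<k} (\<lambda>_. borel))"
  using \<open>j \<le> k\<close>
proof (induction j)
  case (Suc j)
  define st where "st s = iterate_state A W b \<eta> w0 s j" for s :: "nat \<Rightarrow> real^'t^'m"
  define N where "N = PiM {..<k} (\<lambda>_. borel :: (real^'t^'m) measure)"
  have "st \<in> borel_measurable N"
    using Suc unfolding st_def N_def by simp
  then have [measurable]: "(\<lambda>s. fst (snd (st s))) \<in> borel_measurable N"
    "(\<lambda>s. snd (snd (st s))) \<in> borel_measurable N"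
    by (auto intro!: measurable_compose[of st N borel, OF _ borel_measurable_continuous_onI]
        continuous_on_fst continuous_on_snd)
  have "(\<lambda>s. s j) \<in> borel_measurable N"
    using Suc.prems unfolding N_def by (intro measurable_component_singleton) auto
  then have "(\<lambda>s. H_mat A W (s j)) \<in> borel_measurable N"
    using H by (rule measurable_compose)
  then have [measurable]: "(\<lambda>s. grad_W A W b (s j) (fst (snd (st s)))) \<in> borel_measurable N"
    unfolding grad_W_def matrix_vector_mul_assoc[symmetric]
    by (intro borel_measurable_matrix_vector_mult borel_measurable_diff) simp_all
  have "iterate_state A W b \<eta> w0 s (Suc j) = (fst (snd (st s)),
      (1 - 1 / (zeta \<eta> (j + 1) + 1)) *\<^sub>R fst (snd (st s)) + (1 / (zeta \<eta> (j + 1) + 1)) *\<^sub>R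
        (snd (snd (st s)) - \<eta> *\<^sub>R grad_W A W b (s j) (fst (snd (st s)))),
      snd (snd (st s)) - \<eta> *\<^sub>R grad_W A W b (s j) (fst (snd (st s))))" for s
    by (simp add: st_def Let_def split: prod.split)
  then show ?case
    unfolding N_def[symmetric] by (simp only:) (intro borel_measurable_Pair; measurable)
qed simp

text \<open>For fixed \<open>e\<close> the loss is linear in \<open>H_mat A W S\<close>, so the
  integral passes to the matrix.\<close>

lemma nn_integral_sketch_loss:
  fixes D :: "(real^'t^'m) measure"
  assumes A: "sym_pos_def A" and W: "sym_pos_def W" and int: "integrable D (H_mat A W)"
  shows "(\<integral>\<^sup>+ S. ennreal (sketch_loss A W S e) \<partial>D)
    = ennreal ((A *v e) \<bullet> (expected_H A W D *v (A *v e)))"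
proof -
  have L: "bounded_linear (\<lambda>C :: real^'m^'m. (A *v e) \<bullet> (C *v (A *v e)))"
    by (intro linear_conv_bounded_linear[THEN iffD1] linearI)
      (simp_all add: matrix_vector_mult_add_rdistrib inner_add_right flip: scaleR_matrix_vector_assoc)
  show ?thesis
    unfolding sketch_loss_def expected_H_def integral_bounded_linear[OF L int, symmetric]
    by (intro nn_integral_eq_integral integrable_bounded_linear[OF L int] AE_I2 inner_H_mat_nonneg[OF A W])
qed

lemma expected_H_symmetric:
  fixes D :: "(real^'t^'m) measure"
  assumes A: "sym_pos_def A" and W: "sym_pos_def W"
  shows "transpose (expected_H A W D) = expected_H A W D"
proof (cases "integrable D (H_mat A W)")
  case True
  have L: "bounded_linear (transpose :: real^'m^'m \<Rightarrow> real^'m^'m)"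
    by (intro linear_conv_bounded_linear[THEN iffD1] linearI) (simp_all add: transpose_def vec_eq_iff)
  show ?thesis
    unfolding expected_H_def integral_bounded_linear[OF L True, symmetric]
    by (simp only: H_mat_symmetric[OF A W])
next
  case False
  then show ?thesis
    by (simp add: expected_H_def not_integrable_integral_eq transpose_def vec_eq_iff)
qed

lemma expected_H_pos_semidef:
  assumes A: "sym_pos_def A" and W: "sym_pos_def W"
  shows "0 \<le> x \<bullet> (expected_H A W D *v x)"
proof (cases "integrable D (H_mat A W)")
  case True
  have L: "bounded_linear (\<lambda>C :: real^'a^'a. x \<bullet> (C *v x))"
    by (intro linear_conv_bounded_linear[THEN iffD1] linearI)
      (simp_all add: matrix_vector_mult_add_rdistrib inner_add_right flip: scaleR_matrix_vector_assoc)
  have "0 \<le> (\<integral>S. x \<bullet> (H_mat A W S *v x) \<partial>D)"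
    by (intro Bochner_Integration.integral_nonneg inner_H_mat_nonneg[OF A W])
  then show ?thesis
    using integral_bounded_linear[OF L True] by (simp add: expected_H_def)
qed (simp add: expected_H_def not_integrable_integral_eq)

lemma lambda_min_expected_H_nonneg:
  assumes A: "sym_pos_def A" and W: "sym_pos_def W"
  shows "0 \<le> lambda_min (expected_H A W D)"
proof -
  obtain v where "v \<noteq> 0" "expected_H A W D *v v = lambda_min (expected_H A W D) *\<^sub>R v"
    using lambda_min_symmetric(1)[OF expected_H_symmetric[OF A W]] by (auto simp: is_eigenvalue_def)
  then show ?thesis
    using expected_H_pos_semidef[OF A W, of v D] by (simp add: zero_le_mult_iff) (metis inner_gt_zero_iff not_le)
qed

text \<open>The Bochner integral is \<open>0\<close> when \<open>H\<^sub>S\<close> is not integrable, so a nonzero eigenvalue yields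
  integrability, and with it the measurability of \<open>H\<^sub>S\<close>.\<close>

lemma integrable_H_mat:
  assumes "lambda_min (expected_H A W D) \<noteq> 0"
  shows "integrable D (H_mat A W)"
  using assms not_integrable_integral_eq[of D "H_mat A W"] lambda_min_zero
  by (metis expected_H_def)

text \<open>Since \<open>e\<close> depends on the first \<open>k\<close> samples only, it can be
  frozen while \<open>S k\<close> is averaged out.\<close>

lemma (in prob_space) expected_sketch_loss_indep:
  fixes S :: "nat \<Rightarrow> 'a \<Rightarrow> real^'t^'m"
  assumes A: "sym_pos_def A" and W: "sym_pos_def W" and int: "integrable D (H_mat A W)"
    and H: "(H_mat A W :: real^'t^'m \<Rightarrow> real^'m^'m) \<in> borel_measurable borel"
    and ind: "indep_vars (\<lambda>_. borel) S UNIV" and D: "distr M borel (S k) = D"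
    and f: "f \<in> borel_measurable (PiM {..<k} (\<lambda>_. borel))"
    and e: "\<And>\<omega>. \<omega> \<in> space M \<Longrightarrow> e \<omega> = f (restrict (\<lambda>i. S i \<omega>) {..<k})"
  shows "(\<integral>\<^sup>+ \<omega>. ennreal (sketch_loss A W (S k \<omega>) (e \<omega>)) \<partial>M)
    = (\<integral>\<^sup>+ \<omega>. ennreal ((A *v e \<omega>) \<bullet> (expected_H A W D *v (A *v e \<omega>))) \<partial>M)"
proof -
  define N where "N = PiM {..<k} (\<lambda>_. borel :: (real^'t^'m) measure)"
  define L where "L = PiM {k} (\<lambda>_. borel :: (real^'t^'m) measure)"
  define X where "X \<omega> = restrict (\<lambda>i. S i \<omega>) {..<k}" for \<omega>
  define Y where "Y \<omega> = restrict (\<lambda>i. S i \<omega>) {k}" for \<omega>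
  have ind': "indep_var N X L Y"
    unfolding N_def L_def X_def Y_def by (rule indep_var_restrict[OF ind]) auto
  define h where "h p = ennreal (sketch_loss A W (snd p k) (f (fst p)))"
    for p :: "(nat \<Rightarrow> real^'t^'m) \<times> (nat \<Rightarrow> real^'t^'m)"
  have "(\<lambda>y. y k) \<in> borel_measurable L"
    unfolding L_def by (intro measurable_component_singleton) simp
  then have "(\<lambda>p. H_mat A W (snd p k)) \<in> borel_measurable (N \<Otimes>\<^sub>M L)"
    by (intro measurable_compose[OF measurable_snd] measurable_compose[OF _ H])
  moreover have "(\<lambda>p. f (fst p)) \<in> borel_measurable (N \<Otimes>\<^sub>M L)"
    using measurable_fst f[folded N_def] by (rule measurable_compose)
  ultimately have h: "h \<in> borel_measurable (N \<Otimes>\<^sub>M L)"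
    unfolding h_def sketch_loss_def
    by (intro measurable_compose[OF _ measurable_ennreal] borel_measurable_inner
        borel_measurable_matrix_vector_mult) simp_all
  have S: "S k \<in> borel_measurable M"
    using ind by (simp add: indep_vars_def)
  have inner: "(\<integral>\<^sup>+ \<omega>'. ennreal (sketch_loss A W (S k \<omega>') v) \<partial>M)
      = ennreal ((A *v v) \<bullet> (expected_H A W D *v (A *v v)))" for v
  proof -
    have "(\<lambda>T :: real^'t^'m. ennreal (sketch_loss A W T v)) \<in> borel_measurable (distr M borel (S k))"
      unfolding sketch_loss_def
      by (intro measurable_compose[OF _ measurable_ennreal] borel_measurable_inner
          borel_measurable_matrix_vector_mult) (simp_all add: H)
    from nn_integral_distr[OF S this] show ?thesis
      by (simp add: D nn_integral_sketch_loss[OF A W int])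
  qed
  have "(\<integral>\<^sup>+ \<omega>. ennreal (sketch_loss A W (S k \<omega>) (e \<omega>)) \<partial>M) = (\<integral>\<^sup>+ \<omega>. h (X \<omega>, Y \<omega>) \<partial>M)"
    by (intro nn_integral_cong) (simp add: h_def X_def Y_def e)
  also have "\<dots> = (\<integral>\<^sup>+ \<omega>. (\<integral>\<^sup>+ \<omega>'. h (X \<omega>, Y \<omega>') \<partial>M) \<partial>M)"
    by (rule nn_integral_indep_var[OF ind' h])
  also have "\<dots> = (\<integral>\<^sup>+ \<omega>. ennreal ((A *v e \<omega>) \<bullet> (expected_H A W D *v (A *v e \<omega>))) \<partial>M)"
    by (intro nn_integral_cong) (simp add: h_def X_def Y_def e inner)
  finally show ?thesis .
qed

section \<open>Convergence\<close>

locale averaging_method = prob_space M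
  for M :: "'a measure" +
  fixes A W :: "real^'m^'m"
    and b w0 wstar :: "real^'m"
    and D :: "(real^'t^'m) measure"
    and S :: "nat \<Rightarrow> 'a \<Rightarrow> real^'t^'m"
    and w z :: "int \<Rightarrow> 'a \<Rightarrow> real^'m"
    and \<eta> :: real
  assumes A: "sym_pos_def A" and W: "sym_pos_def W" and b: "A *v wstar = b"
    and sets_D: "sets D = sets borel"
    and indep: "indep_vars (\<lambda>_. borel) S UNIV"
    and distr_S: "\<And>k. distr M borel (S k) = D"
    and \<eta>: "0 < \<eta>" "\<eta> < 1"
    and iterates: "\<And>\<omega>. \<omega> \<in> space M \<Longrightarrow>
           averaging_iterates A W b \<eta> (\<lambda>k. S k \<omega>) w0 (\<lambda>k. w k \<omega>) (\<lambda>k. z k \<omega>)"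
begin

text \<open>The gradient vanishes at \<open>wstar\<close>. This serves the degenerate case where the
  bound reads infinity times zero, which is zero in \<open>ennreal\<close>.\<close>

lemma iterates_eq_solution:
  assumes "w0 = wstar" "\<omega> \<in> space M"
  shows "w (int k) \<omega> = wstar"
proof -
  have "iterate_state A W b \<eta> w0 (\<lambda>k. S k \<omega>) k = (wstar, wstar, wstar)"
    by (induction k) (simp_all add: assms grad_W_solution[OF b] Let_def flip: scaleR_left_distrib)
  then show ?thesis
    using averaging_iterates_state[OF iterates[OF assms(2)]] by simp
qed

text \<open>The shifted index makes \<open>lyapunov 0\<close> the initial squared distance.\<close>

definition lyapunov :: "nat \<Rightarrow> 'a \<Rightarrow> real" where
  "lyapunov k \<omega> = (wnorm W (z (int k - 1) \<omega> - wstar))\<^sup>2"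

lemma descent:
  assumes "\<omega> \<in> space M"
  shows "lyapunov (Suc k) \<omega> + \<eta> * (zeta \<eta> k + 2 - \<eta>) * sketch_loss A W (S k \<omega>) (w (int k) \<omega> - wstar)
    \<le> lyapunov k \<omega> + \<eta> * zeta \<eta> k * sketch_loss A W (S k \<omega>) (w (int k - 1) \<omega> - wstar)"
proof -
  note it = iterates[OF assms, unfolded averaging_iterates_def]
  have z: "z (int (Suc k) - 1) \<omega> = z (int k - 1) \<omega> - \<eta> *\<^sub>R grad_W A W b (S k \<omega>) (w (int k) \<omega>)"
    using it by simp
  have "w (int k) \<omega> = w (int k - 1) \<omega>
      + (1 / (zeta \<eta> k + 1)) *\<^sub>R (z (int k - 1) \<omega> - w (int k - 1) \<omega>)"
  proof (cases k)
    \<comment> \<open>No averaging step has produced \<open>w 0\<close>, but all three starting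
      points coincide.\<close>
    case 0
    then show ?thesis using it by simp
  next
    case (Suc j)
    have "w (int j + 1) \<omega> = (1 - 1 / (zeta \<eta> (j + 1) + 1)) *\<^sub>R w (int j) \<omega>
        + (1 / (zeta \<eta> (j + 1) + 1)) *\<^sub>R z (int j) \<omega>"
      using it by blast
    moreover have "int k = int j + 1" "int k - 1 = int j" "zeta \<eta> k = zeta \<eta> (j + 1)"
      using Suc by simp_all
    ultimately show ?thesis
      by (simp only:) (simp add: algebra_simps)
  qed
  then show ?thesis
    unfolding lyapunov_def z
    by (intro averaging_step_descent[OF A W b \<eta>(1)]) (use \<eta> in \<open>simp_all add: zeta_eq\<close>)
qed

lemma zeta_nonneg: "0 \<le> zeta \<eta> k"
  using \<eta> by (simp add: zeta_eq)

lemma S_measurable: "S k \<in> borel_measurable M"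
  using indep by (simp add: indep_vars_def)

lemma iterates_eq_state:
  assumes "\<omega> \<in> space M"
  shows "iterate_state A W b \<eta> w0 (restrict (\<lambda>i. S i \<omega>) {..<k}) k
    = (w (int k - 1) \<omega>, w (int k) \<omega>, z (int k - 1) \<omega>)"
proof -
  have "iterate_state A W b \<eta> w0 (restrict (\<lambda>i. S i \<omega>) {..<k}) k
      = iterate_state A W b \<eta> w0 (\<lambda>i. S i \<omega>) k"
    by (rule iterate_state_cong) simp
  then show ?thesis
    using averaging_iterates_state[OF iterates[OF assms]] by simp
qed

section \<open>Mean descent for integrable H_S\<close>

context
  assumes int: "integrable D (H_mat A W)"
begin

text \<open>This takes the place of a direct proof that \<open>pinv\<close> is Borel
  measurable.\<close>

lemma H_measurable: "(H_mat A W :: real^'t^'m \<Rightarrow> real^'m^'m) \<in> borel_measurable borel"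
  using borel_measurable_integrable[OF int] by (simp add: sets_D cong: measurable_cong_sets)

lemma state_component_measurable:
  assumes p: "continuous_on UNIV p"
  shows "(\<lambda>s. p (iterate_state A W b \<eta> w0 s k)) \<in> borel_measurable (PiM {..<k} (\<lambda>_. borel :: (real^'t^'m) measure))"
    and "(\<lambda>\<omega>. p (w (int k - 1) \<omega>, w (int k) \<omega>, z (int k - 1) \<omega>)) \<in> borel_measurable M"
proof -
  show 1: "(\<lambda>s. p (iterate_state A W b \<eta> w0 s k)) \<in> borel_measurable (PiM {..<k} (\<lambda>_. borel :: (real^'t^'m) measure))"
    using measurable_iterate_state[OF H_measurable order_refl] borel_measurable_continuous_onI[OF p]
    by (rule measurable_compose)
  have "(\<lambda>\<omega>. restrict (\<lambda>i. S i \<omega>) {..<k}) \<in> measurable M (PiM {..<k} (\<lambda>_. borel))"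
    by (intro measurable_restrict S_measurable)
  from measurable_compose[OF this 1]
  show "(\<lambda>\<omega>. p (w (int k - 1) \<omega>, w (int k) \<omega>, z (int k - 1) \<omega>)) \<in> borel_measurable M"
    by (rule measurable_cong[THEN iffD1, rotated]) (simp only: iterates_eq_state)
qed

lemma iterates_measurable:
  "w (int k - 1) \<in> borel_measurable M" "w (int k) \<in> borel_measurable M"
  "z (int k - 1) \<in> borel_measurable M"
proof -
  show "w (int k - 1) \<in> borel_measurable M"
    using state_component_measurable(2)[of fst k] by (simp add: continuous_on_fst)
  show "w (int k) \<in> borel_measurable M"
    using state_component_measurable(2)[of "\<lambda>p. fst (snd p)" k]
    by (simp add: continuous_on_fst continuous_on_snd)
  show "z (int k - 1) \<in> borel_measurable M"
    using state_component_measurable(2)[of "\<lambda>p. snd (snd p)" k] by (simp add: continuous_on_snd)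
qed

definition mean_loss :: "int \<Rightarrow> ennreal" where
  "mean_loss i = (\<integral>\<^sup>+ \<omega>. ennreal ((A *v (w i \<omega> - wstar)) \<bullet>
     (expected_H A W D *v (A *v (w i \<omega> - wstar)))) \<partial>M)"

text \<open>Both iterates depend on the first \<open>k\<close> samples only. So the loss of the
  previous iterate under the fresh sample has the same mean as in the preceding step, which lets the
  inequalities telescope.\<close>

lemma mean_sketch_loss:
  shows "(\<integral>\<^sup>+ \<omega>. ennreal (sketch_loss A W (S k \<omega>) (w (int k) \<omega> - wstar)) \<partial>M) = mean_loss (int k)"
    and "(\<integral>\<^sup>+ \<omega>. ennreal (sketch_loss A W (S k \<omega>) (w (int k - 1) \<omega> - wstar)) \<partial>M) = mean_loss (int k - 1)"
proof -
  have current: "continuous_on UNIV (\<lambda>p :: (real^'m) \<times> (real^'m) \<times> (real^'m). fst (snd p) - wstar)"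
    and previous: "continuous_on UNIV (\<lambda>p :: (real^'m) \<times> (real^'m) \<times> (real^'m). fst p - wstar)"
    by (intro continuous_on_diff continuous_on_fst continuous_on_snd continuous_on_id continuous_on_const)+
  note mean = expected_sketch_loss_indep[OF A W int H_measurable indep distr_S state_component_measurable(1)]
  show "(\<integral>\<^sup>+ \<omega>. ennreal (sketch_loss A W (S k \<omega>) (w (int k) \<omega> - wstar)) \<partial>M) = mean_loss (int k)"
    unfolding mean_loss_def by (rule mean[OF current]) (simp add: iterates_eq_state)
  show "(\<integral>\<^sup>+ \<omega>. ennreal (sketch_loss A W (S k \<omega>) (w (int k - 1) \<omega> - wstar)) \<partial>M) = mean_loss (int k - 1)"
    unfolding mean_loss_def by (rule mean[OF previous]) (simp add: iterates_eq_state)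
qed

lemma lyapunov_measurable: "lyapunov k \<in> borel_measurable M"
  unfolding lyapunov_def wnorm_square[OF W]
  by (intro borel_measurable_inner borel_measurable_matrix_vector_mult borel_measurable_diff)
    (simp_all add: iterates_measurable)

lemma sketch_loss_measurable:
  assumes "f \<in> borel_measurable M"
  shows "(\<lambda>\<omega>. sketch_loss A W (S k \<omega>) (f \<omega> - wstar)) \<in> borel_measurable M"
  unfolding sketch_loss_def
  by (intro borel_measurable_inner borel_measurable_matrix_vector_mult borel_measurable_diff
      measurable_compose[OF S_measurable H_measurable]) (simp_all add: assms)

text \<open>Stated with sums on both sides, since the expectations are not yet known to be finite
  and cannot be subtracted.\<close>

lemma mean_descent:
  "(\<integral>\<^sup>+ \<omega>. ennreal (lyapunov (Suc k) \<omega>) \<partial>M) + ennreal (\<eta> * (zeta \<eta> k + 2 - \<eta>)) * mean_loss (int k)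
    \<le> (\<integral>\<^sup>+ \<omega>. ennreal (lyapunov k \<omega>) \<partial>M) + ennreal (\<eta> * zeta \<eta> k) * mean_loss (int k - 1)"
proof -
  have split: "(\<integral>\<^sup>+ \<omega>. ennreal (lyapunov j \<omega> + c * sketch_loss A W (S k \<omega>) (f \<omega> - wstar)) \<partial>M)
      = (\<integral>\<^sup>+ \<omega>. ennreal (lyapunov j \<omega>) \<partial>M)
        + ennreal c * (\<integral>\<^sup>+ \<omega>. ennreal (sketch_loss A W (S k \<omega>) (f \<omega> - wstar)) \<partial>M)"
    if "0 \<le> c" "f \<in> borel_measurable M" for j c f
  proof -
    have "(\<integral>\<^sup>+ \<omega>. ennreal (lyapunov j \<omega> + c * sketch_loss A W (S k \<omega>) (f \<omega> - wstar)) \<partial>M)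
      = (\<integral>\<^sup>+ \<omega>. ennreal (lyapunov j \<omega>) + ennreal c * ennreal (sketch_loss A W (S k \<omega>) (f \<omega> - wstar)) \<partial>M)"
      using that by (intro nn_integral_cong)
        (simp add: sketch_loss_nonneg[OF A W] lyapunov_def ennreal_mult ennreal_plus)
    then show ?thesis
      using measurable_compose[OF lyapunov_measurable measurable_ennreal]
        measurable_compose[OF sketch_loss_measurable[OF that(2)] measurable_ennreal]
      by (simp add: nn_integral_add nn_integral_cmult)
  qed
  have c: "0 \<le> \<eta> * (zeta \<eta> k + 2 - \<eta>)" "0 \<le> \<eta> * zeta \<eta> k"
    using \<eta> zeta_nonneg[of k] by simp_all
  show ?thesis
    unfolding mean_sketch_loss[symmetric]
      split[OF c(1) iterates_measurable(2), symmetric] split[OF c(2) iterates_measurable(1), symmetric]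
    by (intro nn_integral_mono ennreal_leI descent)
qed

lemma mean_loss_bound:
  "ennreal (\<eta> * (zeta \<eta> k + 2 - \<eta>)) * mean_loss (int k) \<le> ennreal ((wnorm W (w0 - wstar))\<^sup>2)"
proof -
  \<comment> \<open>Keeping the Lyapunov term makes the claim inductive. At \<open>k = 0\<close> the
    loss at index \<open>-1\<close> drops out because \<open>zeta \<eta> 0 = 0\<close>.\<close>
  have "(\<integral>\<^sup>+ \<omega>. ennreal (lyapunov (Suc k) \<omega>) \<partial>M)
      + ennreal (\<eta> * (zeta \<eta> k + 2 - \<eta>)) * mean_loss (int k) \<le> ennreal ((wnorm W (w0 - wstar))\<^sup>2)"
  proof (induction k)
    case 0
    have "(\<integral>\<^sup>+ \<omega>. ennreal (lyapunov 0 \<omega>) \<partial>M) = (\<integral>\<^sup>+ \<omega>. ennreal ((wnorm W (w0 - wstar))\<^sup>2) \<partial>M)"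
      using iterates by (intro nn_integral_cong) (simp add: lyapunov_def averaging_iterates_def)
    also have "\<dots> = ennreal ((wnorm W (w0 - wstar))\<^sup>2)"
      by (simp add: emeasure_space_1)
    finally show ?case
      using mean_descent[of 0] by (simp add: zeta_def)
  next
    case (Suc k)
    have "ennreal (\<eta> * zeta \<eta> (Suc k)) \<le> ennreal (\<eta> * (zeta \<eta> k + 2 - \<eta>))"
      using \<eta> by (intro ennreal_leI mult_left_mono) (simp_all add: zeta_eq algebra_simps)
    then have "ennreal (\<eta> * zeta \<eta> (Suc k)) * mean_loss (int k)
        \<le> ennreal (\<eta> * (zeta \<eta> k + 2 - \<eta>)) * mean_loss (int k)"
      by (rule mult_right_mono) simp
    then have "(\<integral>\<^sup>+ \<omega>. ennreal (lyapunov (Suc k) \<omega>) \<partial>M) + ennreal (\<eta> * zeta \<eta> (Suc k)) * mean_loss (int k)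
        \<le> ennreal ((wnorm W (w0 - wstar))\<^sup>2)"
      using Suc by (meson add_left_mono order_trans)
    moreover have "int (Suc k) - 1 = int k"
      by simp
    ultimately show ?case
      using mean_descent[of "Suc k"] by (simp only:)
  qed
  then show ?thesis
    by (rule order_trans[rotated]) simp
qed

text \<open>The smallest eigenvalue of the mean matrix turns the bound on \<open>mean_loss\<close>
  into one on the squared residual.\<close>

lemma mean_residual_bound:
  assumes "0 < lambda_min (expected_H A W D)" (is "0 < ?l")
  shows "(\<integral>\<^sup>+ \<omega>. ennreal ((norm (A *v w (int k) \<omega> - b))\<^sup>2) \<partial>M)
    \<le> ennreal ((wnorm W (w0 - wstar))\<^sup>2 / (?l * (\<eta> * (real k * (1 - \<eta>) + 2 - \<eta>))))"
proof -
  let ?I = "\<integral>\<^sup>+ \<omega>. ennreal ((norm (A *v w (int k) \<omega> - b))\<^sup>2) \<partial>M"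
  define c where "c = \<eta> * (zeta \<eta> k + 2 - \<eta>)"
  have c: "0 < c"
    unfolding c_def using \<eta> zeta_nonneg[of k] by simp
  have "(\<lambda>\<omega>. (norm (A *v w (int k) \<omega> - b))\<^sup>2) \<in> borel_measurable M"
    by (intro borel_measurable_power measurable_compose[OF _ borel_measurable_norm] borel_measurable_diff
        borel_measurable_matrix_vector_mult) (simp_all add: iterates_measurable)
  then have "ennreal ?l * ?I = (\<integral>\<^sup>+ \<omega>. ennreal ?l * ennreal ((norm (A *v w (int k) \<omega> - b))\<^sup>2) \<partial>M)"
    by (intro nn_integral_cmult[symmetric] measurable_compose[OF _ measurable_ennreal])
  also have "\<dots> \<le> mean_loss (int k)"
    unfolding mean_loss_def
  proof (rule nn_integral_mono)
    fix \<omega>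
    have "A *v (w (int k) \<omega> - wstar) = A *v w (int k) \<omega> - b"
      using b by (simp add: matrix_vector_mult_diff_distrib)
    then show "ennreal ?l * ennreal ((norm (A *v w (int k) \<omega> - b))\<^sup>2)
        \<le> ennreal ((A *v (w (int k) \<omega> - wstar)) \<bullet> (expected_H A W D *v (A *v (w (int k) \<omega> - wstar))))"
      using lambda_min_symmetric(2)[OF expected_H_symmetric[OF A W], of D "A *v w (int k) \<omega> - b"] assms
      by (simp add: ennreal_leI dot_square_norm flip: ennreal_mult)
  qed
  finally have "ennreal c * (ennreal ?l * ?I) \<le> ennreal ((wnorm W (w0 - wstar))\<^sup>2)"
    using mean_loss_bound[of k, folded c_def] by (meson mult_left_mono order_trans zero_le)
  \<comment> \<open>Multiplication by a positive finite constant replaces division, as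
    \<open>?I\<close> may a priori be infinite.\<close>
  then have "ennreal (1 / (?l * c)) * (ennreal c * (ennreal ?l * ?I))
      \<le> ennreal (1 / (?l * c)) * ennreal ((wnorm W (w0 - wstar))\<^sup>2)"
    by (rule mult_left_mono) simp
  moreover have "ennreal (1 / (?l * c)) * (ennreal c * (ennreal ?l * ?I)) = ?I"
  proof -
    have "ennreal (1 / (?l * c)) * (ennreal c * ennreal ?l) = 1"
      using c assms by (simp flip: ennreal_mult)
    then show ?thesis
      by (simp add: mult.assoc[symmetric])
  qed
  moreover have "ennreal (1 / (?l * c)) * ennreal ((wnorm W (w0 - wstar))\<^sup>2)
      = ennreal ((wnorm W (w0 - wstar))\<^sup>2 / (?l * c))"
    using c assms by (simp flip: ennreal_mult)
  ultimately show ?thesis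
    by (simp add: c_def zeta_eq)
qed

end

lemma mean_residual_bound_quot_inf:
  assumes "1 \<le> k"
  shows "(\<integral>\<^sup>+ \<omega>. ennreal ((norm (A *v w (int k) \<omega> - b))\<^sup>2) \<partial>M)
      \<le> quot_inf 1 (lambda_min (expected_H A W D)) * ennreal (1 / real k)
          * ennreal ((wnorm W (w0 - wstar))\<^sup>2 / (\<eta> * (1 - \<eta>)))"
proof (cases "lambda_min (expected_H A W D) = 0")
  case True
  show ?thesis
  \<comment> \<open>The right-hand side is infinite unless \<open>w0 = wstar\<close>, where it is
    zero and the residual has to vanish.\<close>
  proof (cases "w0 = wstar")
    case True
    then have "(\<integral>\<^sup>+ \<omega>. ennreal ((norm (A *v w (int k) \<omega> - b))\<^sup>2) \<partial>M) = (\<integral>\<^sup>+ \<omega>. 0 \<partial>M)"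
      using b by (intro nn_integral_cong) (simp add: iterates_eq_solution)
    then show ?thesis by simp
  next
    case False
    then have "0 < (wnorm W (w0 - wstar))\<^sup>2"
      using sym_pos_defD(2,3)[OF W, of "w0 - wstar"] by (simp add: wnorm_square[OF W] less_le)
    then show ?thesis
      using True assms \<eta> by (simp add: quot_inf_def ennreal_top_mult ennreal_mult_top)
  qed
next
  case False
  then have pos: "0 < lambda_min (expected_H A W D)" (is "0 < ?l")
    using lambda_min_expected_H_nonneg[OF A W, of D] by simp
  have int: "integrable D (H_mat A W)"
    using False by (rule integrable_H_mat)
  have "(\<integral>\<^sup>+ \<omega>. ennreal ((norm (A *v w (int k) \<omega> - b))\<^sup>2) \<partial>M)
      \<le> ennreal ((wnorm W (w0 - wstar))\<^sup>2 / (?l * (\<eta> * (real k * (1 - \<eta>) + 2 - \<eta>))))"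
    by (rule mean_residual_bound[OF int pos])
  also have "\<dots> \<le> ennreal ((wnorm W (w0 - wstar))\<^sup>2 / (?l * (\<eta> * (real k * (1 - \<eta>)))))"
  proof -
    have "\<eta> < real k * (1 - \<eta>) + 2"
      using \<eta> zeta_nonneg[of k] unfolding zeta_eq by linarith
    then show ?thesis
      using pos \<eta> assms by (intro ennreal_leI divide_left_mono mult_left_mono mult_pos_pos) simp_all
  qed
  also have "\<dots> = quot_inf 1 ?l * ennreal (1 / real k) * ennreal ((wnorm W (w0 - wstar))\<^sup>2 / (\<eta> * (1 - \<eta>)))"
    using pos \<eta> by (simp add: quot_inf_def mult_ac flip: ennreal_mult)
  finally show ?thesis .
qed

lemma mean_residual_less:
  assumes half: "\<eta> = 1 / 2" and \<epsilon>: "0 < \<epsilon>"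
    and t: "quot_inf (4 * (wnorm W (w0 - wstar))\<^sup>2) (lambda_min (expected_H A W D))
         * ennreal (1 / \<epsilon>) \<le> ennreal (real t)"
  shows "(\<integral>\<^sup>+ \<omega>. ennreal ((norm (A *v w (int t) \<omega> - b))\<^sup>2) \<partial>M) < ennreal \<epsilon>"
proof -
  let ?l = "lambda_min (expected_H A W D)" and ?V = "(wnorm W (w0 - wstar))\<^sup>2"
  \<comment> \<open>At \<open>?l = 0\<close> the required iteration count would be infinite,
    contradicting the finite \<open>t\<close>.\<close>
  have nz: "?l \<noteq> 0"
    using t \<epsilon> by (auto simp: quot_inf_def ennreal_top_mult top_unique)
  then have pos: "0 < ?l"
    using lambda_min_expected_H_nonneg[OF A W, of D] by simp
  have int: "integrable D (H_mat A W)"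
    using nz by (rule integrable_H_mat)
  have "4 * ?V / ?l * (1 / \<epsilon>) \<le> real t"
    using t pos \<epsilon> by (simp add: quot_inf_def flip: ennreal_mult)
  then have "4 * ?V \<le> real t * (?l * \<epsilon>)"
    using pos \<epsilon> by (simp add: field_simps)
  \<comment> \<open>Strictness comes from the 3: for \<eta> = 1/2 the denominator factor of the
    sharper bound is \<open>(real t + 3) / 4\<close>.\<close>
  also have "\<dots> < (real t + 3) * (?l * \<epsilon>)"
    using pos \<epsilon> by simp
  finally have lt: "4 * ?V < (real t + 3) * (?l * \<epsilon>)" .
  have "?V / (?l * ((real t + 3) / 4)) < \<epsilon>"
  proof -
    have "0 < ?l * ((real t + 3) / 4)"
      using pos by (intro mult_pos_pos) simp_all
    moreover have "?V < \<epsilon> * (?l * ((real t + 3) / 4))"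
      using lt by (simp add: algebra_simps)
    ultimately show ?thesis
      by (rule pos_divide_less_eq[THEN iffD2])
  qed
  moreover have "\<eta> * (real t * (1 - \<eta>) + 2 - \<eta>) = (real t + 3) / 4"
    by (simp add: half field_simps)
  ultimately have less: "?V / (?l * (\<eta> * (real t * (1 - \<eta>) + 2 - \<eta>))) < \<epsilon>"
    by (simp only:)
  show ?thesis
    using mean_residual_bound[OF int pos, of t] ennreal_lessI[OF \<epsilon> less] by (rule le_less_trans)
qed

end

theorem corollary6p3:
  fixes A W :: "real^'m^'m"
    and b w0 wstar :: "real^'m"
    and D :: "(real^'t^'m) measure"
    and M :: "'a measure"
    and S :: "nat \<Rightarrow> 'a \<Rightarrow> real^'t^'m"
    and w z :: "int \<Rightarrow> 'a \<Rightarrow> real^'m"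
    and \<eta> :: real
  assumes "sym_pos_def A"
    and "sym_pos_def W"
    and "A *v wstar = b"
    and "prob_space D"
    and "sets D = sets borel"
    and "prob_space M"
    and "prob_space.indep_vars M (\<lambda>_. borel) S UNIV"
    and "\<And>k. distr M borel (S k) = D"
    and "0 < \<eta>"
    and "\<eta> < 1"
    and "\<And>\<omega>. \<omega> \<in> space M \<Longrightarrow>
           averaging_iterates A W b \<eta> (\<lambda>k. S k \<omega>) w0 (\<lambda>k. w k \<omega>) (\<lambda>k. z k \<omega>)"
  shows "(\<forall>(s :: nat \<Rightarrow> real^'t^'m) u.
            (\<exists>v. averaging_iterates A W b \<eta> s w0 u v) \<longleftrightarrow> momentum_iterates A W b \<eta> s w0 u) \<and>
         (\<forall>k::nat. 1 \<le> k \<longrightarrow>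
            (\<integral>\<^sup>+ \<omega>. ennreal ((norm (A *v w (int k) \<omega> - b))\<^sup>2) \<partial>M)
              \<le> quot_inf 1 (lambda_min (expected_H A W D)) * ennreal (1 / real k)
                  * ennreal ((wnorm W (w0 - wstar))\<^sup>2 / (\<eta> * (1 - \<eta>)))) \<and>
         (\<eta> = 1 / 2 \<longrightarrow>
            (\<forall>\<epsilon> > 0. \<forall>t::nat.
               quot_inf (4 * (wnorm W (w0 - wstar))\<^sup>2) (lambda_min (expected_H A W D))
                   * ennreal (1 / \<epsilon>) \<le> ennreal (real t) \<longrightarrow>
               (\<integral>\<^sup>+ \<omega>. ennreal ((norm (A *v w (int t) \<omega> - b))\<^sup>2) \<partial>M) < ennreal \<epsilon>))"
proof -
  interpret averaging_method M A W b w0 wstar D S w z \<eta>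
    using assms by (auto simp: averaging_method_def averaging_method_axioms_def)
  show ?thesis
    by (intro conjI allI impI averaging_iff_momentum mean_residual_bound_quot_inf mean_residual_less \<eta>)
qed

end
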